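(* Let $D\ge 1$, $L\ge 2$ be integers, let $\boldsymbol{\mu}_1,\dots,\boldsymbol{\mu}_L\in\mathbb{R}^D$, let $\mathbf{C}\in\mathbb{R}^{D\times D}$ be symmetric positive definite, let $K_a\ge 1$ be an integer, and let $\sigma_{\mathrm{nor}}^2>0$ and $\gamma_{\mathrm{sen}}>0$ be real. Let $S\in\{1,\dots,D\}$, let $G\ge 1$ be an integer, and let $\mathbf{P}=[\mathbf{u}_1,\dots,\mathbf{u}_S]$ be the DG-based compression matrix, with associated eigenvalues $\lambda_d$ and eigenvector discriminant gains $W_d$. Then the receive discriminant gain obtained with this compression matrix $\mathbf{P}$ and processing gain $G$, denoted $\hat{\mathcal{G}}(S,G)$, is $$\hat{\mathcal{G}}(S,G)=K_a\sum_{d=1}^{S}\frac{W_d}{\hat\sigma^2/(G\lambda_d)+1},\qquad \hat\sigma^2=\frac{\sigma_{\mathrm{nor}}^2}{K_a\gamma_{\mathrm{sen}}}.$$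
   Context: Here $D$ is the feature dimension, $L$ the number of classes, $\boldsymbol{\mu}_\ell$ the centroid of class $\ell$, $\mathbf{C}$ the common class covariance matrix, $K_a=|\mathcal{K}|$ the number of active sensors, $\sigma_{\mathrm{nor}}^2$ the normalization variance, and $\gamma_{\mathrm{sen}}$ the receive signal-to-interference ratio. The closest class pair is a pair $(\ell,\ell')$ with $$(\ell,\ell')\in\arg\min_{\ell_1\ne\ell_2}(\boldsymbol{\mu}_{\ell_1}-\boldsymbol{\mu}_{\ell_2})^{\mathsf T}\mathbf{C}^{-1}(\boldsymbol{\mu}_{\ell_1}-\boldsymbol{\mu}_{\ell_2}),$$ fixed once and for all, and $\boldsymbol{\mu}_{\ell\ell'}=\boldsymbol{\mu}_\ell-\boldsymbol{\mu}_{\ell'}$. For a compression matrix $\mathbf{P}\in\mathbb{R}^{D\times S}$ of full column rank $S$ and processing gain $G$ (a positive integer), the covariance matrix of the received feature vector is $$\hat{\mathbf{C}}=\frac{1}{K_a}\mathbf{P}^{\mathsf T}\mathbf{C}\mathbf{P}+\frac{\sigma_{\mathrm{nor}}^2}{G K_a^2\gamma_{\mathrm{sen}}}\mathbf{I}_S,$$ and the receive discriminant gain is $\boldsymbol{\mu}_{\ell\ell'}^{\mathsf T}\mathbf{P}\hat{\mathbf{C}}^{-1}\mathbf{P}^{\mathsf T}\boldsymbol{\mu}_{\ell\ell'}$. DG-based compression matrix: write the eigenvalue decomposition $\mathbf{C}=\mathbf{U}\Sigma_C\mathbf{U}^{\mathsf T}$ with $\mathbf{U}=[\mathbf{u}_1,\dots,\mathbf{u}_D]$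 orthogonal and $\Sigma_C=\mathrm{diag}\{\lambda_1,\dots,\lambda_D\}$. Let $\gamma_d$ be the $d$-th entry of $\mathbf{U}^{\mathsf T}\boldsymbol{\mu}_{\ell\ell'}$, and define the discriminant gain of $\mathbf{u}_d$ by $W_d=\gamma_d^2/\lambda_d$. The eigenvectors are indexed so that $W_1\ge W_2\ge\dots\ge W_D$. The DG-based compression matrix of dimension $S$ is $\mathbf{P}=[\mathbf{u}_1,\mathbf{u}_2,\dots,\mathbf{u}_S]$. *)

theory Defs
  imports Complex_Main
    "Jordan_Normal_Form.Matrix"
    "Jordan_Normal_Form.Gauss_Jordan_Elimination"
begin

text \<open>Rows, columns, classes and eigenvectors are numbered from 0, as in the matrix library:
  \<open>col U d\<close> is the (d+1)-st eigenvector and the classes are \<open>0, ..., L - 1\<close>.\<close>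

text \<open>Meaningful for invertible square matrices only; \<open>mat_inv A\<close> is unspecified otherwise.\<close>

definition mat_inv :: "real mat \<Rightarrow> real mat" where
  "mat_inv A = the (mat_inverse A)"

lemma mat_inv_eqI:
  assumes A: "A \<in> carrier_mat n n" and B: "B \<in> carrier_mat n n"
    and AB: "A * B = 1\<^sub>m n" and BA: "B * A = 1\<^sub>m n"
  shows "mat_inv A = B"
proof -
  have "A \<in> Units (ring_mat TYPE(real) n ())"
    using assms unfolding Units_def ring_mat_def by auto
  with mat_inverse(1)[OF A, where b = "()"] obtain X where X: "mat_inverse A = Some X"
    by (cases "mat_inverse A") auto
  from mat_inverse(2)[OF A X] have AX: "A * X = 1\<^sub>m n" and XC: "X \<in> carrier_mat n n"
    by auto
  have "X = (B * A) * X" using BA XC by simp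
  also have "\<dots> = B * (A * X)" using assoc_mult_mat[OF B A XC] .
  also have "\<dots> = B" using AX B by simp
  finally show ?thesis using X by (simp add: mat_inv_def)
qed

definition sym_pos_def :: "nat \<Rightarrow> real mat \<Rightarrow> bool" where
  "sym_pos_def n A \<longleftrightarrow> A \<in> carrier_mat n n \<and> A\<^sup>T = A \<and>
     (\<forall>v \<in> carrier_vec n. v \<noteq> 0\<^sub>v n \<longrightarrow> v \<bullet> (A *\<^sub>v v) > 0)"

definition is_closest_pair ::
    "nat \<Rightarrow> (nat \<Rightarrow> real vec) \<Rightarrow> real mat \<Rightarrow> nat \<times> nat \<Rightarrow> bool" where
  "is_closest_pair L mu C p \<longleftrightarrow>
     is_arg_min (\<lambda>(l1, l2). (mu l1 - mu l2) \<bullet> (mat_inv C *\<^sub>v (mu l1 - mu l2)))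
       (\<lambda>(l1, l2). l1 < L \<and> l2 < L \<and> l1 \<noteq> l2) p"

definition received_cov ::
    "nat \<Rightarrow> real mat \<Rightarrow> real \<Rightarrow> real \<Rightarrow> real mat \<Rightarrow> nat \<Rightarrow> real mat" where
  "received_cov Ka C sigma_nor_sq gamma_sen P G =
     (1 / real Ka) \<cdot>\<^sub>m (P\<^sup>T * C * P) +
     (sigma_nor_sq / (real G * (real Ka)\<^sup>2 * gamma_sen)) \<cdot>\<^sub>m 1\<^sub>m (dim_col P)"

definition receive_discriminant_gain ::
    "nat \<Rightarrow> real mat \<Rightarrow> real \<Rightarrow> real \<Rightarrow> real vec \<Rightarrow> real mat \<Rightarrow> nat \<Rightarrow> real" where
  "receive_discriminant_gain Ka C sigma_nor_sq gamma_sen m P G =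
     (P\<^sup>T *\<^sub>v m) \<bullet> (mat_inv (received_cov Ka C sigma_nor_sq gamma_sen P G) *\<^sub>v (P\<^sup>T *\<^sub>v m))"

definition eigvec_gain :: "real mat \<Rightarrow> (nat \<Rightarrow> real) \<Rightarrow> real vec \<Rightarrow> nat \<Rightarrow> real" where
  "eigvec_gain U lam m d = ((U\<^sup>T *\<^sub>v m) $ d)\<^sup>2 / lam d"

text \<open>Orthogonality of \<open>U\<close> is spelled out because the library's \<open>orthogonal_mat\<close> only asks for
  pairwise orthogonal nonzero columns, not for unit ones.\<close>

definition dg_eigendecomposition ::
    "nat \<Rightarrow> real mat \<Rightarrow> real vec \<Rightarrow> real mat \<Rightarrow> (nat \<Rightarrow> real) \<Rightarrow> bool" where
  "dg_eigendecomposition D C m U lam \<longleftrightarrow>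
     U \<in> carrier_mat D D \<and> U\<^sup>T * U = 1\<^sub>m D \<and> U * U\<^sup>T = 1\<^sub>m D \<and>
     C = U * mat_diag D lam * U\<^sup>T \<and>
     (\<forall>i j. i \<le> j \<and> j < D \<longrightarrow> eigvec_gain U lam m j \<le> eigvec_gain U lam m i)"

definition dg_compression_matrix :: "real mat \<Rightarrow> nat \<Rightarrow> real mat" where
  "dg_compression_matrix U S = mat_of_cols (dim_row U) (map (col U) [0..<S])"

end

theory Submission
  imports Defs
begin

text \<open>In the eigenbasis of \<open>C\<close> everything is diagonal. The columns of
  \<open>P\<close> are orthonormal eigenvectors, so \<open>P\<^sup>T * C * P\<close> is the diagonal
  matrix of the first \<open>S\<close> eigenvalues (\<open>dg_eigendecomposition_congruence\<close>,
  \<open>congruence_dg_compression_matrix\<close>). The noise term only adds a constant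
  \<open>c\<close> to the diagonal, so the received covariance has diagonal entries
  \<open>q d = lam d / Ka + c\<close>. These are positive because positive definiteness makes the
  eigenvalues positive (\<open>dg_eigendecomposition_eigenvalue_pos\<close>). Inverting entry by
  entry (\<open>mat_inv_mat_diag\<close>) turns the gain into a weighted sum of squares
  (\<open>quadratic_form_mat_diag\<close>), and factoring \<open>lam d / Ka\<close> out of
  \<open>q d\<close> gives the stated summands.\<close>

lemma dg_compression_matrix_carrier:
  "U \<in> carrier_mat n k \<Longrightarrow> dg_compression_matrix U S \<in> carrier_mat n S"
  unfolding dg_compression_matrix_def by (auto simp: mat_of_cols_def)

lemma col_dg_compression_matrix:
  assumes "U \<in> carrier_mat n k" and "d < S" and "S \<le> k"
  shows "col (dg_compression_matrix U S) d = col U d"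
proof -
  have "map (col U) [0..<S] ! d \<in> carrier_vec (dim_row U)"
    using assms by auto
  then show ?thesis
    unfolding dg_compression_matrix_def using assms by (simp add: col_mat_of_cols)
qed

text \<open>Compression keeps the first \<open>S\<close> coordinates in the eigenbasis, so the
  squares in the gain are the numerators of \<open>eigvec_gain\<close>.\<close>

lemma dg_compression_matrix_transpose_mult_vec:
  assumes "U \<in> carrier_mat n k" and "d < S" and "S \<le> k"
  shows "((dg_compression_matrix U S)\<^sup>T *\<^sub>v v) $ d = (U\<^sup>T *\<^sub>v v) $ d"
  using assms dg_compression_matrix_carrier[OF assms(1), of S]
  by (simp add: col_dg_compression_matrix)

text \<open>An entry depends on \<open>B\<close> only through two of its columns, which allows
  \<open>U\<close> to be exchanged for a matrix that shares those columns.\<close>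

lemma congruence_index:
  fixes A B :: "'a :: semiring_1 mat"
  assumes B: "B \<in> carrier_mat n k" and A: "A \<in> carrier_mat n n" and "i < k" and "j < k"
  shows "(B\<^sup>T * A * B) $$ (i, j) = col B i \<bullet> (A *\<^sub>v col B j)"
proof -
  have "B\<^sup>T * A * B = B\<^sup>T * (A * B)"
    using A B by (intro assoc_mult_mat) auto
  then show ?thesis
    using assms by (simp add: col_mult2[OF A B])
qed

text \<open>Dropping the trailing columns of \<open>U\<close> cuts the leading \<open>S\<close> by
  \<open>S\<close> block out of \<open>U\<^sup>T * A * U\<close>, and such a block of a diagonal
  matrix is diagonal.\<close>

lemma congruence_dg_compression_matrix:
  assumes U: "U \<in> carrier_mat n k" and A: "A \<in> carrier_mat n n" and S: "S \<le> k"
    and diag: "U\<^sup>T * A * U = mat_diag k f"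
  shows "(dg_compression_matrix U S)\<^sup>T * A * dg_compression_matrix U S = mat_diag S f"
proof (rule eq_matI)
  let ?P = "dg_compression_matrix U S"
  have P: "?P \<in> carrier_mat n S"
    using U by (rule dg_compression_matrix_carrier)
  show "dim_row (?P\<^sup>T * A * ?P) = dim_row (mat_diag S f)"
    and "dim_col (?P\<^sup>T * A * ?P) = dim_col (mat_diag S f)"
    using P by (auto simp: mat_diag_def)
  fix i j assume "i < dim_row (mat_diag S f)" and "j < dim_col (mat_diag S f)"
  then have ij: "i < S" "j < S" by (auto simp: mat_diag_def)
  have "(?P\<^sup>T * A * ?P) $$ (i, j) = (U\<^sup>T * A * U) $$ (i, j)"
    using ij S by (simp add: congruence_index[OF P A] congruence_index[OF U A]
        col_dg_compression_matrix[OF U])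
  also have "\<dots> = mat_diag S f $$ (i, j)"
    unfolding diag using ij S by (simp add: mat_diag_def)
  finally show "(?P\<^sup>T * A * ?P) $$ (i, j) = mat_diag S f $$ (i, j)" .
qed

lemma mat_inv_mat_diag:
  assumes "\<And>i. i < n \<Longrightarrow> f i \<noteq> 0"
  shows "mat_inv (mat_diag n f) = mat_diag n (\<lambda>i. 1 / f i)"
proof (rule mat_inv_eqI)
  show "mat_diag n f * mat_diag n (\<lambda>i. 1 / f i) = 1\<^sub>m n"
    and "mat_diag n (\<lambda>i. 1 / f i) * mat_diag n f = 1\<^sub>m n"
    unfolding mat_diag_diag using assms by (auto simp: mat_diag_def)
qed simp_all

lemma quadratic_form_mat_diag:
  fixes v :: "'a :: comm_semiring_1 vec"
  assumes v: "v \<in> carrier_vec n"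
  shows "v \<bullet> (mat_diag n f *\<^sub>v v) = (\<Sum>i<n. f i * (v $ i)\<^sup>2)"
proof -
  have "(mat_diag n f *\<^sub>v v) $ i = f i * v $ i" if "i < n" for i
  proof -
    have "(mat_diag n f *\<^sub>v v) $ i = (\<Sum>j = 0..<n. (if i = j then f j else 0) * v $ j)"
      using v that by (simp add: mat_diag_def scalar_prod_def)
    also have "\<dots> = (\<Sum>j = 0..<n. if j = i then f j * v $ j else 0)"
      by (intro sum.cong) auto
    also have "\<dots> = f i * v $ i"
      using that by simp
    finally show ?thesis .
  qed
  moreover have "dim_vec (mat_diag n f *\<^sub>v v) = n"
    by (simp add: mat_diag_def)
  ultimately show ?thesis
    by (auto simp: scalar_prod_def power2_eq_square mult_ac lessThan_atLeast0 intro!: sum.cong)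
qed

lemma dg_eigendecomposition_congruence:
  assumes "dg_eigendecomposition n C m U lam"
  shows "U\<^sup>T * C * U = mat_diag n lam"
proof -
  have U: "U \<in> carrier_mat n n" "U\<^sup>T \<in> carrier_mat n n" and UU: "U\<^sup>T * U = 1\<^sub>m n"
    and C: "C = U * mat_diag n lam * U\<^sup>T"
    using assms unfolding dg_eigendecomposition_def by auto
  have L: "mat_diag n lam \<in> carrier_mat n n"
    by simp
  \<comment> \<open>Reassociating brings \<open>U\<^sup>T\<close> next to \<open>U\<close>, where
    orthogonality cancels them; the right-hand factor \<open>U\<close> cancels in the same way
    below.\<close>
  have "U\<^sup>T * C = (U\<^sup>T * U) * (mat_diag n lam * U\<^sup>T)"
    unfolding C assoc_mult_mat[OF U(1) L U(2)]
    using assoc_mult_mat[OF U(2) U(1) mult_carrier_mat[OF L U(2)]] by simp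
  then have "U\<^sup>T * C = mat_diag n lam * U\<^sup>T"
    unfolding UU left_mult_one_mat[OF mult_carrier_mat[OF L U(2)]] .
  then show ?thesis
    using assoc_mult_mat[OF L U(2) U(1)] UU right_mult_one_mat[OF L] by argo
qed

text \<open>The eigenvalue is the quadratic form of \<open>C\<close> evaluated at its eigenvector
  \<open>col U d\<close>.\<close>

lemma dg_eigendecomposition_eigenvalue_pos:
  assumes "sym_pos_def n C" and dg: "dg_eigendecomposition n C m U lam" and d: "d < n"
  shows "lam d > 0"
proof -
  have C: "C \<in> carrier_mat n n" and pos: "\<And>v. v \<in> carrier_vec n \<Longrightarrow> v \<noteq> 0\<^sub>v n \<Longrightarrow> v \<bullet> (C *\<^sub>v v) > 0"
    using assms(1) unfolding sym_pos_def_def by auto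
  have U: "U \<in> carrier_mat n n" and UU: "U\<^sup>T * U = 1\<^sub>m n"
    using dg unfolding dg_eigendecomposition_def by auto
  \<comment> \<open>Positive definiteness needs a nonzero vector; the column has unit length by
    orthogonality.\<close>
  have "col U d \<bullet> col U d = (U\<^sup>T * U) $$ (d, d)"
    using U d by simp
  then have "col U d \<bullet> col U d = 1"
    using UU d by simp
  then have "col U d \<noteq> 0\<^sub>v n"
    using U d by auto
  then have "0 < col U d \<bullet> (C *\<^sub>v col U d)"
    using U d by (intro pos) auto
  also have "\<dots> = (U\<^sup>T * C * U) $$ (d, d)"
    using congruence_index[OF U C d d] by simp
  also have "\<dots> = lam d"
    using d by (simp add: dg_eigendecomposition_congruence[OF dg] mat_diag_def)
  finally show ?thesis .
qed

theorem proposition1: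
  fixes D L Ka S G l l' :: nat
    and mu :: "nat \<Rightarrow> real vec"
    and C U P :: "real mat"
    and lam :: "nat \<Rightarrow> real"
    and sigma_nor_sq gamma_sen sigma_hat_sq :: real
  assumes "D \<ge> 1" and "L \<ge> 2"
    and "\<And>k. k < L \<Longrightarrow> mu k \<in> carrier_vec D"
    and "sym_pos_def D C"
    and "Ka \<ge> 1" and "sigma_nor_sq > 0" and "gamma_sen > 0"
    and "1 \<le> S" and "S \<le> D" and "G \<ge> 1"
    and "is_closest_pair L mu C (l, l')"
    and "dg_eigendecomposition D C (mu l - mu l') U lam"
    and "P = dg_compression_matrix U S"
    and "sigma_hat_sq = sigma_nor_sq / (real Ka * gamma_sen)"
  shows "receive_discriminant_gain Ka C sigma_nor_sq gamma_sen (mu l - mu l') P G =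
    real Ka * (\<Sum>d<S. eigvec_gain U lam (mu l - mu l') d /
      (sigma_hat_sq / (real G * lam d) + 1))"
proof -
  define m where "m = mu l - mu l'"
  \<comment> \<open>Here \<open>c\<close> is the coefficient of the identity in the received
    covariance, and \<open>q d\<close> will be its eigenvalues.\<close>
  define c where "c = sigma_nor_sq / (real G * (real Ka)\<^sup>2 * gamma_sen)"
  define q where "q d = lam d / real Ka + c" for d
  have dg: "dg_eigendecomposition D C m U lam"
    using assms(12) unfolding m_def .
  then have U: "U \<in> carrier_mat D D"
    unfolding dg_eigendecomposition_def by simp
  have C: "C \<in> carrier_mat D D"
    using assms(4) unfolding sym_pos_def_def by simp
  have P: "P \<in> carrier_mat D S"
    unfolding assms(13) using U by (rule dg_compression_matrix_carrier)
  have c_pos: "c > 0"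
    using assms(5-7,10) unfolding c_def by simp
  have lam_pos: "lam d > 0" if "d < S" for d
    using dg_eigendecomposition_eigenvalue_pos[OF assms(4) dg] that assms(9) by simp
  have q_pos: "q d > 0" if "d < S" for d
    unfolding q_def using lam_pos[OF that] c_pos assms(5) by (simp add: add_pos_pos)
  have PCP: "P\<^sup>T * C * P = mat_diag S lam"
    unfolding assms(13)
    using congruence_dg_compression_matrix[OF U C assms(9) dg_eigendecomposition_congruence[OF dg]] .
  have cov: "received_cov Ka C sigma_nor_sq gamma_sen P G = mat_diag S q"
    unfolding received_cov_def PCP c_def[symmetric] using P
    by (intro eq_matI) (auto simp: mat_diag_def q_def)
  have inv: "mat_inv (mat_diag S q) = mat_diag S (\<lambda>d. 1 / q d)"
    using q_pos by (intro mat_inv_mat_diag) (simp add: less_imp_neq[symmetric])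
  have v: "P\<^sup>T *\<^sub>v m \<in> carrier_vec S"
    using P by (intro carrier_vecI) simp
  have "receive_discriminant_gain Ka C sigma_nor_sq gamma_sen m P G =
      (\<Sum>d<S. 1 / q d * ((P\<^sup>T *\<^sub>v m) $ d)\<^sup>2)"
    unfolding receive_discriminant_gain_def cov inv using v by (rule quadratic_form_mat_diag)
  also have "\<dots> = (\<Sum>d<S. real Ka *
      (eigvec_gain U lam m d / (sigma_hat_sq / (real G * lam d) + 1)))"
  proof (rule sum.cong[OF refl])
    fix d assume "d \<in> {..<S}"
    then have d: "d < S" by simp
    \<comment> \<open>One of the two factors \<open>Ka\<close> in \<open>c\<close> cancels and the
      other belongs to \<open>sigma_hat_sq\<close>, so \<open>Ka * c = sigma_hat_sq / G\<close>;
      then \<open>lam d\<close> is factored out. This factor becomes the denominator of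
      \<open>eigvec_gain\<close>.\<close>
    have "real Ka * q d = lam d * (sigma_hat_sq / (real G * lam d) + 1)"
      unfolding q_def c_def assms(14) using lam_pos[OF d] assms(5-7,10)
      by (simp add: field_simps power2_eq_square)
    then have q: "q d = lam d * (sigma_hat_sq / (real G * lam d) + 1) / real Ka"
      using assms(5) by (simp add: field_simps)
    have "(P\<^sup>T *\<^sub>v m) $ d = (U\<^sup>T *\<^sub>v m) $ d"
      unfolding assms(13) using U d assms(9) by (rule dg_compression_matrix_transpose_mult_vec)
    then show "1 / q d * ((P\<^sup>T *\<^sub>v m) $ d)\<^sup>2 =
        real Ka * (eigvec_gain U lam m d / (sigma_hat_sq / (real G * lam d) + 1))"
      unfolding q eigvec_gain_def by simp
  qed
  finally show ?thesis
    by (simp add: m_def sum_distrib_left)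
qed

end
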